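(* Let $\mathcal H$ be a real Hilbert space; let $f,g,h$ be proper closed convex functions on $\mathcal H$ with $h$ differentiable and $\nabla h$ $(1/\beta)$-Lipschitz, $\beta>0$; let $\overline A,\overline B:\mathcal H\to\mathcal H$ be bounded skew linear maps ($\overline A^\ast=-\overline A$, $\overline B^\ast=-\overline B$). Let $A=\partial f+\overline A$ and $B=\partial g+\overline B$ be maximal monotone and $C=\nabla h$. Let $\varepsilon\in(0,1)$, $\gamma\in(0,2\beta\varepsilon)$, $\alpha=1/(2-\varepsilon)$, $\lambda\in(0,1/\alpha]$. Let $T:=I_{\mathcal H}-J_{\gamma B}+J_{\gamma A}\circ(2J_{\gamma B}-I_{\mathcal H}-\gamma C\circ J_{\gamma B})$ have a fixed point $z^\ast$, and let $x^\ast=J_{\gamma B}(z^\ast)$. Let $z^0\in\mathcal H$, $z^{k+1}=(1-\lambda)z^k+\lambda Tz^k$, $x_B^k:=J_{\gamma B}(z^k)$, $x_A^k:=J_{\gamma A}(2x_B^k-z^k-\gamma Cx_B^k)$, and $$\overline x_A^k=\frac2{(k+1)(k+2)}\sum_{i=0}^k(i+1)x_A^i,\qquad\overline x_B^k=\frac2{(k+1)(k+2)}\sum_{i=0}^k(i+1)x_B^i.$$ Then: 1. For all $k\ge0$ and $x\in\mathrm{dom}(f)\cap\mathrm{dom}(g)$, $$\begin{aligned}&f(\overline x_A^k)+g(\overline x_B^k)+h(\overline x_B^k)-(f+g+h)(x)+\langle-x,\overline A\,\overline x_B^k+\overline B\,\overline x_B^k\rangle\\&\le\frac{2\|z^\ast-x\|^2+\left(2+\frac{\gamma}{2\beta\varepsilon-\gamma}\right)\|z^0-z^\ast\|^2+10\gamma\|z^0-z^\ast\|\,\|Cx^\ast\|+5\gamma\|\overline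 A\|\,\|x\|\,\|z^0-z^\ast\|}{\gamma\lambda(k+1)}.\end{aligned}$$ 2. Suppose $f$ is $L_f$-Lipschitz continuous on the closed ball of center $x^\ast$ and radius $(1+\gamma/\beta)\|z^0-z^\ast\|$. Then for all $k\ge0$ and $x\in\mathrm{dom}(f)\cap\mathrm{dom}(g)$, $$\begin{aligned}&f(\overline x_B^k)+g(\overline x_B^k)+h(\overline x_B^k)-(f+g+h)(x)+\langle-x,\overline A\,\overline x_B^k+\overline B\,\overline x_B^k\rangle\\&\le\frac{2\|z^\ast-x\|^2+\left(2+\frac{\gamma}{2\beta\varepsilon-\gamma}\right)\|z^0-z^\ast\|^2+10\gamma\|z^0-z^\ast\|\,\|Cx^\ast\|+5\gamma\|\overline A\|\,\|x\|\,\|z^0-z^\ast\|+5\gamma L_f\|z^0-z^\ast\|}{\gamma\lambda(k+1)}.\end{aligned}$$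
   Context: $J_S:=(I_{\mathcal H}+S)^{-1}$ is the resolvent of a maximal monotone operator $S$; $\partial$ is the convex subdifferential; $\|\overline A\|$ is the operator norm. *)

theory Defs
  imports "HOL-Analysis.Analysis"
begin

definition ereal_epigraph :: "('a \<Rightarrow> ereal) \<Rightarrow> ('a \<times> real) set" where
  "ereal_epigraph f = {(x, r). f x \<le> ereal r}"

definition eff_domain :: "('a \<Rightarrow> ereal) \<Rightarrow> 'a set" where
  "eff_domain f = {x. f x < \<infinity>}"

definition proper_fun :: "('a \<Rightarrow> ereal) \<Rightarrow> bool" where
  "proper_fun f \<longleftrightarrow> (\<forall>x. f x \<noteq> -\<infinity>) \<and> eff_domain f \<noteq> {}"

definition proper_closed_convex :: "('a::real_normed_vector \<Rightarrow> ereal) \<Rightarrow> bool" where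
  "proper_closed_convex f \<longleftrightarrow>
     proper_fun f \<and> closed (ereal_epigraph f) \<and> convex (ereal_epigraph f)"

text \<open>For proper \<open>f\<close> the subdifferential is empty outside the effective domain.\<close>

definition subdifferential :: "('a::real_inner \<Rightarrow> ereal) \<Rightarrow> 'a \<Rightarrow> 'a set" where
  "subdifferential f x = {u. \<forall>y. f y \<ge> f x + ereal (inner u (y - x))}"

text \<open>Set-valued operators on a space are functions into its power set.\<close>

definition op_plus :: "('a \<Rightarrow> 'a set) \<Rightarrow> ('a \<Rightarrow> 'a set) \<Rightarrow> 'a \<Rightarrow> ('a::plus) set" where
  "op_plus S R x = {u + v | u v. u \<in> S x \<and> v \<in> R x}"

definition op_scale :: "real \<Rightarrow> ('a \<Rightarrow> 'a set) \<Rightarrow> 'a \<Rightarrow> ('a::real_vector) set" where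
  "op_scale c S x = {c *\<^sub>R u | u. u \<in> S x}"

definition op_inverse :: "('a \<Rightarrow> 'a set) \<Rightarrow> 'a \<Rightarrow> 'a set" where
  "op_inverse S u = {x. u \<in> S x}"

definition op_of_fun :: "('a \<Rightarrow> 'a) \<Rightarrow> 'a \<Rightarrow> 'a set" where
  "op_of_fun F x = {F x}"

definition monotone_op :: "('a::real_inner \<Rightarrow> 'a set) \<Rightarrow> bool" where
  "monotone_op S \<longleftrightarrow>
     (\<forall>x y. \<forall>u\<in>S x. \<forall>v\<in>S y. inner (u - v) (x - y) \<ge> 0)"

definition maximal_monotone :: "('a::real_inner \<Rightarrow> 'a set) \<Rightarrow> bool" where
  "maximal_monotone S \<longleftrightarrow>
     monotone_op S \<and> (\<forall>R. monotone_op R \<longrightarrow> (\<forall>x. S x \<subseteq> R x) \<longrightarrow> R = S)"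

text \<open>On a Hilbert space, the inverse of \<open>I + S\<close> is everywhere defined and single-valued when
  \<open>S\<close> is maximal monotone (Minty's theorem), so \<^const>\<open>the_elem\<close> is then applied to a singleton.\<close>

definition resolvent :: "('a \<Rightarrow> 'a set) \<Rightarrow> 'a \<Rightarrow> ('a::real_inner)" where
  "resolvent S z = the_elem (op_inverse (op_plus (op_of_fun id) S) z)"

definition bounded_skew :: "('a::real_inner \<Rightarrow> 'a) \<Rightarrow> bool" where
  "bounded_skew F \<longleftrightarrow> bounded_linear F \<and> adjoint F = (\<lambda>x. - F x)"

text \<open>Lipschitz continuity of an extended-real-valued function on \<open>D\<close> includes its finiteness
  there.\<close>

definition ereal_lipschitz_on :: "real \<Rightarrow> 'a::metric_space set \<Rightarrow> ('a \<Rightarrow> ereal) \<Rightarrow> bool" where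
  "ereal_lipschitz_on L D f \<longleftrightarrow>
     (\<forall>x\<in>D. \<bar>f x\<bar> \<noteq> \<infinity>) \<and> L-lipschitz_on D (\<lambda>x. real_of_ereal (f x))"

end

theory Submission
  imports Defs
begin

text \<open>
  Write \<open>d\<close> for \<open>xB k - xA k\<close>, so that \<open>z k - z (Suc k) = lam d\<close>. The subgradients selected by the two
  resolvents, together with the gradient inequality for \<open>h\<close>, bound the gap at step \<open>k\<close> by the decrease
  of \<open>(norm (z k - x))\<^sup>2\<close>, up to the term \<open>inner d (C (xB k))\<close>. Its part \<open>inner d (C (xB k) - C xstar)\<close> is
  absorbed by Young's inequality, and the resulting square of \<open>C (xB k) - C xstar\<close> is paid for by the
  Fejer-type decrease of \<open>(norm (z k - zstar))\<^sup>2\<close>, which contains it because \<open>C\<close> is cocoercive. The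
  remaining part \<open>inner d (C xstar)\<close> telescopes. Summing with the weights \<open>k + 1\<close> turns each telescoping
  difference into an average of bounded quantities, of order \<open>k + 1\<close>, while the weights have total mass
  of order \<open>(k + 1)\<^sup>2\<close>; Jensen's inequality transfers the bound to the averages. The same summation by
  parts bounds \<open>xbarB k - xbarA k\<close>, which allows exchanging these two points in \<open>Abar\<close> and, if \<open>f\<close> is
  Lipschitz, in \<open>f\<close>.
\<close>

section \<open>Subgradients and proximal points\<close>

lemma ereal_epigraphI: "f x \<le> ereal r \<Longrightarrow> (x, r) \<in> ereal_epigraph f"
  by (simp add: ereal_epigraph_def)

lemma subdifferential_finite:
  assumes "proper_fun f" "u \<in> subdifferential f x"
  shows "\<bar>f x\<bar> \<noteq> \<infinity>"
proof -
  from assms(1) obtain y where y: "f y < \<infinity>" by (auto simp: proper_fun_def eff_domain_def)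
  have "f y \<ge> f x + ereal (inner u (y - x))" using assms(2) by (simp add: subdifferential_def)
  with y have "f x \<noteq> \<infinity>" by auto
  moreover have "f x \<noteq> -\<infinity>" using assms(1) by (simp add: proper_fun_def)
  ultimately show ?thesis by auto
qed

lemma eff_domain_finite:
  assumes "proper_fun f" "x \<in> eff_domain f"
  shows "\<bar>f x\<bar> \<noteq> \<infinity>"
  using assms by (auto simp: proper_fun_def eff_domain_def)

lemma subgradient_inequality:
  assumes "proper_fun f" "u \<in> subdifferential f x" "y \<in> eff_domain f"
  shows "real_of_ereal (f x) + inner u (y - x) \<le> real_of_ereal (f y)"
proof -
  have "f y \<ge> f x + ereal (inner u (y - x))" using assms(2) by (simp add: subdifferential_def)
  moreover obtain a where "f x = ereal a" using subdifferential_finite[OF assms(1,2)] by (cases "f x") auto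
  moreover obtain b where "f y = ereal b" using eff_domain_finite[OF assms(1,3)] by (cases "f y") auto
  ultimately show ?thesis by simp
qed

lemma subdifferential_in_domain:
  assumes "proper_fun f" "u \<in> subdifferential f x"
  shows "x \<in> eff_domain f"
  using subdifferential_finite[OF assms] by (auto simp: eff_domain_def)

lemma subdifferential_monotone:
  assumes "proper_fun f" "u \<in> subdifferential f x" "v \<in> subdifferential f y"
  shows "inner (u - v) (x - y) \<ge> 0"
  using subgradient_inequality[OF assms(1,2) subdifferential_in_domain[OF assms(1,3)]]
    subgradient_inequality[OF assms(1,3) subdifferential_in_domain[OF assms(1,2)]]
  by (simp add: inner_diff_left inner_diff_right)

text \<open>The points \<open>(x i, f (x i))\<close> lie in the convex epigraph, hence so does their
  convex combination. Because the right-hand side is finite, the inequality also keeps the average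
  in the effective domain.\<close>

lemma jensen_ereal:
  assumes f: "proper_closed_convex f" and S: "finite S" "\<And>i. i \<in> S \<Longrightarrow> 0 \<le> w i" "sum w S = 1"
    and dom: "\<And>i. i \<in> S \<Longrightarrow> x i \<in> eff_domain f"
  shows "f (\<Sum>i\<in>S. w i *\<^sub>R x i) \<le> ereal (\<Sum>i\<in>S. w i * real_of_ereal (f (x i)))"
proof -
  have "(x i, real_of_ereal (f (x i))) \<in> ereal_epigraph f" if "i \<in> S" for i
    using eff_domain_finite[OF _ dom[OF that]] f
    by (intro ereal_epigraphI) (simp add: proper_closed_convex_def ereal_real)
  then have "(\<Sum>i\<in>S. w i *\<^sub>R (x i, real_of_ereal (f (x i)))) \<in> ereal_epigraph f"
    using f S by (intro convex_sum) (auto simp: proper_closed_convex_def)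
  moreover have "(\<Sum>i\<in>S. w i *\<^sub>R (x i, real_of_ereal (f (x i)))) =
      (\<Sum>i\<in>S. w i *\<^sub>R x i, \<Sum>i\<in>S. w i * real_of_ereal (f (x i)))"
    by (rule prod_eqI) (simp_all add: fst_sum snd_sum)
  ultimately show ?thesis by (simp add: ereal_epigraph_def)
qed

text \<open>Divide by \<open>t\<close> and let \<open>t\<close> tend to 0 from the right. This
  extracts the first-order optimality condition from minimality along a segment.\<close>

lemma slope_nonneg_if_quadratic_nonneg:
  fixes a b :: real
  assumes "\<And>t. 0 < t \<Longrightarrow> t < 1 \<Longrightarrow> 0 \<le> t * a + t\<^sup>2 * b"
  shows "0 \<le> a"
proof (rule tendsto_lowerbound)
  show "((\<lambda>t. a + t * b) \<longlongrightarrow> a) (at_right 0)"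
    by (rule tendsto_eq_intros refl | simp)+
  have "eventually (\<lambda>t. t \<in> {0<..<1}) (at_right (0::real))"
    by (rule eventually_at_right_real) simp
  then show "eventually (\<lambda>t. 0 \<le> a + t * b) (at_right 0)"
  proof eventually_elim
    case (elim t)
    then have "0 \<le> t * (a + t * b)" using assms[of t] by (simp add: algebra_simps power2_eq_square)
    with elim show ?case by (simp add: zero_le_mult_iff)
  qed
qed simp

text \<open>The point \<open>x\<close> minimises \<open>f y + (norm (y - v))^2 / (2 * s)\<close>,
  and the inclusion is its optimality condition. Minimising over the epigraph, with the height as a
  second variable, keeps all values real; closedness of the epigraph takes the place of lower
  semicontinuity.\<close>

lemma prox_exists:
  fixes f :: "'a::{real_inner, complete_space} \<Rightarrow> ereal"
  assumes f: "proper_closed_convex f" and s: "s > 0"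
    and below: "\<And>y r. f y \<le> ereal r \<Longrightarrow> m0 \<le> r + (norm (y - v))\<^sup>2 / (2 * s)"
  shows "\<exists>x. (1 / s) *\<^sub>R (v - x) \<in> subdifferential f x"
proof -
  define E where "E = ereal_epigraph f"
  define G where "G p = snd p + (norm (fst p - v))\<^sup>2 / (2 * s)" for p :: "'a \<times> real"
  define m where "m = (INF p\<in>E. G p)"
  have E: "closed E" "convex E" using f by (auto simp: E_def proper_closed_convex_def)
  \<comment> \<open>by the parallelogram law, a minimising sequence is Cauchy\<close>
  obtain y0 where "f y0 < \<infinity>" "f y0 \<noteq> -\<infinity>"
    using f by (auto simp: proper_closed_convex_def proper_fun_def eff_domain_def)
  then have "(y0, real_of_ereal (f y0)) \<in> E" by (cases "f y0") (auto simp: E_def ereal_epigraph_def)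
  then have ne: "E \<noteq> {}" by auto
  have "m0 \<le> G p" if "p \<in> E" for p
    using that below[of "fst p" "snd p"] by (auto simp: E_def ereal_epigraph_def G_def)
  then have bdd: "bdd_below (G ` E)" by (auto intro!: bdd_belowI2)
  have mG: "m \<le> G p" if "p \<in> E" for p using bdd that by (auto simp: m_def intro: cINF_lower)
  have "\<exists>p\<in>E. G p < m + 1 / (real n + 1)" for n
  proof -
    have "(INF p\<in>E. G p) < m + 1 / (real n + 1)" by (simp add: m_def[symmetric])
    then show ?thesis using cINF_less_iff[OF ne bdd] by blast
  qed
  then obtain p where p: "p n \<in> E" "G (p n) < m + 1 / (real n + 1)" for n by metis
  define y where "y n = fst (p n)" for n
  define r where "r n = snd (p n)" for n
  have mid: "(norm (a - b))\<^sup>2 / (8 * s) \<le> (G (a, q) + G (b, q')) / 2 - m"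
    if "(a, q) \<in> E" "(b, q') \<in> E" for a b q q'
  proof -
    have "(1/2) *\<^sub>R (a, q) + (1/2) *\<^sub>R (b, q') \<in> E" using E that by (intro convexD) auto
    then have "m \<le> G ((1/2) *\<^sub>R (a, q) + (1/2) *\<^sub>R (b, q'))" by (rule mG)
    moreover have "(norm ((1/2) *\<^sub>R a + (1/2) *\<^sub>R b - v))\<^sup>2
        = (norm (a - v))\<^sup>2 / 2 + (norm (b - v))\<^sup>2 / 2 - (norm (a - b))\<^sup>2 / 4"
      by (simp add: power2_norm_eq_inner inner_commute algebra_simps) (simp add: field_simps)
    ultimately have "m \<le> q / 2 + q' / 2 + ((norm (a - v))\<^sup>2 / 2 + (norm (b - v))\<^sup>2 / 2 - (norm (a - b))\<^sup>2 / 4) / (2 * s)"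
      by (simp add: G_def)
    then show ?thesis by (simp add: G_def add_divide_distrib diff_divide_distrib)
  qed
  have dist_bound: "(norm (y n - y k))\<^sup>2 \<le> 8 * s / (real N + 1)" if "N \<le> n" "N \<le> k" for n k N
  proof -
    have "(norm (y n - y k))\<^sup>2 / (8 * s) \<le> (G (p n) + G (p k)) / 2 - m"
      using mid[of "y n" "r n" "y k" "r k"] p by (simp add: y_def r_def)
    also have "\<dots> = ((G (p n) - m) + (G (p k) - m)) / 2" by (simp add: field_simps)
    also have "\<dots> \<le> (1 / (real n + 1) + 1 / (real k + 1)) / 2"
      using less_imp_le[OF p(2)[of n]] less_imp_le[OF p(2)[of k]]
      by (intro divide_right_mono add_mono) (simp_all add: algebra_simps)
    also have "\<dots> \<le> (1 / (real N + 1) + 1 / (real N + 1)) / 2"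
      using that by (intro divide_right_mono add_mono divide_left_mono) auto
    finally show ?thesis using s by (simp add: field_simps)
  qed
  have "Cauchy y"
  proof (rule metric_CauchyI)
    fix e :: real assume e: "e > 0"
    obtain N :: nat where N: "8 * s / e\<^sup>2 < real N" using reals_Archimedean2 by blast
    have "dist (y n) (y k) < e" if "N \<le> n" "N \<le> k" for n k
    proof -
      have "(norm (y n - y k))\<^sup>2 \<le> 8 * s / (real N + 1)" using dist_bound that by blast
      also have "\<dots> < e\<^sup>2" using N e s by (simp add: field_simps) (smt (verit) zero_less_power)
      finally show ?thesis using e by (simp add: dist_norm power_less_imp_less_base)
    qed
    then show "\<exists>M. \<forall>m\<ge>M. \<forall>n\<ge>M. dist (y m) (y n) < e" by blast
  qed
  then obtain x where x: "y \<longlonglongrightarrow> x" using Cauchy_convergent convergent_def by blast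
  \<comment> \<open>Chosen so that \<open>G (x, rx) = m\<close>. The heights \<open>r n\<close>
    converge to \<open>rx\<close>, so closedness puts the minimiser \<open>(x, rx)\<close> in the
    epigraph.\<close>
  define rx where "rx = m - (norm (x - v))\<^sup>2 / (2 * s)"
  have "(\<lambda>n. G (p n)) \<longlonglongrightarrow> m"
  proof (rule tendsto_sandwich[of "\<lambda>n. m" _ _ "\<lambda>n. m + 1 / (real n + 1)"])
    show "(\<lambda>n. m + 1 / (real n + 1)) \<longlonglongrightarrow> m"
      using tendsto_add[OF tendsto_const[of m] LIMSEQ_inverse_real_of_nat]
      by (simp add: inverse_eq_divide add.commute)
  qed (simp_all add: p mG less_imp_le)
  then have "(\<lambda>n. G (p n) - (norm (y n - v))\<^sup>2 / (2 * s)) \<longlonglongrightarrow> rx"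
    unfolding rx_def using s by (intro tendsto_intros x) auto
  then have "r \<longlonglongrightarrow> rx" by (simp add: G_def y_def r_def[abs_def])
  then have "(\<lambda>n. (y n, r n)) \<longlonglongrightarrow> (x, rx)" using x by (intro tendsto_Pair)
  then have xE: "(x, rx) \<in> E" using E(1) p(1) by (auto simp: closed_sequential_limits y_def r_def)
  \<comment> \<open>Optimality of \<open>(x, rx)\<close> along the segment towards
    \<open>(w, q)\<close>: the quadratic part of \<open>G\<close> contributes a term of order
    \<open>t^2\<close>, which does not affect the slope at 0.\<close>
  have var: "rx + inner ((1 / s) *\<^sub>R (v - x)) (w - x) \<le> q" if "(w, q) \<in> E" for w q
  proof -
    have "0 \<le> (q - rx) + inner (x - v) (w - x) / s"
    proof (rule slope_nonneg_if_quadratic_nonneg)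
      fix t :: real assume t: "0 < t" "t < 1"
      have "(1 - t) *\<^sub>R (x, rx) + t *\<^sub>R (w, q) \<in> E" using E that xE t by (intro convexD) auto
      then have 1: "m \<le> G ((1 - t) *\<^sub>R (x, rx) + t *\<^sub>R (w, q))" by (rule mG)
      have 2: "(1 - t) *\<^sub>R x + t *\<^sub>R w - v = (x - v) + t *\<^sub>R (w - x)" by (simp add: algebra_simps)
      have "(norm ((x - v) + t *\<^sub>R (w - x)))\<^sup>2
          = (norm (x - v))\<^sup>2 + 2 * t * inner (x - v) (w - x) + t\<^sup>2 * (norm (w - x))\<^sup>2"
        unfolding power2_norm_eq_inner
        by (simp add: inner_add_left inner_add_right inner_commute) (simp add: power2_eq_square)
      with 1 2 have "m \<le> (1 - t) * rx + t * q
          + ((norm (x - v))\<^sup>2 + 2 * t * inner (x - v) (w - x) + t\<^sup>2 * (norm (w - x))\<^sup>2) / (2 * s)"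
        by (simp add: G_def)
      also have "\<dots> = (1 - t) * rx + t * q + (norm (x - v))\<^sup>2 / (2 * s)
          + t * (inner (x - v) (w - x) / s) + t\<^sup>2 * ((norm (w - x))\<^sup>2 / (2 * s))"
        by (simp add: add_divide_distrib)
      also have "m = rx + (norm (x - v))\<^sup>2 / (2 * s)" by (simp add: rx_def)
      finally show "0 \<le> t * (q - rx + inner (x - v) (w - x) / s) + t\<^sup>2 * ((norm (w - x))\<^sup>2 / (2 * s))"
        by (simp add: left_diff_distrib right_diff_distrib distrib_left)
    qed
    moreover have "inner (v - x) (w - x) = - inner (x - v) (w - x)"
      by (simp add: inner_diff_left)
    ultimately show ?thesis by simp
  qed
  have "f x + ereal (inner ((1 / s) *\<^sub>R (v - x)) (w - x)) \<le> f w" for w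
  proof -
    have "f x + ereal (inner ((1 / s) *\<^sub>R (v - x)) (w - x))
        \<le> ereal rx + ereal (inner ((1 / s) *\<^sub>R (v - x)) (w - x))"
      using xE by (intro add_right_mono) (simp add: E_def ereal_epigraph_def)
    also have "\<dots> \<le> f w"
    proof (cases "f w")
      case (real q)
      then show ?thesis using var[of w q] by (simp add: E_def ereal_epigraph_def)
    next
      case MInf
      then show ?thesis using f by (auto simp: proper_closed_convex_def proper_fun_def)
    qed simp
    finally show ?thesis .
  qed
  then show ?thesis by (auto simp: subdifferential_def)
qed

text \<open>The representing vector comes from the minimiser of \<open>\<phi> y + (norm y)\<^sup>2 / 2\<close>.\<close>

lemma riesz_representation:
  fixes \<phi> :: "'a::{real_inner, complete_space} \<Rightarrow> real"
  assumes "bounded_linear \<phi>"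
  shows "\<exists>u. \<forall>w. \<phi> w = inner u w"
proof -
  interpret bounded_linear \<phi> by fact
  have "closed {p :: 'a \<times> real. \<phi> (fst p) \<le> snd p}"
    by (intro closed_Collect_le continuous_intros continuous_on)
  moreover have "{p :: 'a \<times> real. \<phi> (fst p) \<le> snd p} = ereal_epigraph (\<lambda>x. ereal (\<phi> x))"
    by (auto simp: ereal_epigraph_def)
  moreover have "convex (ereal_epigraph (\<lambda>x. ereal (\<phi> x)))"
    by (auto simp: ereal_epigraph_def convex_def add scaleR intro!: add_mono mult_left_mono)
  ultimately have pcc: "proper_closed_convex (\<lambda>x. ereal (\<phi> x))"
    by (simp add: proper_closed_convex_def proper_fun_def eff_domain_def)
  have "\<exists>x. (1 / 1) *\<^sub>R (0 - x) \<in> subdifferential (\<lambda>x. ereal (\<phi> x)) x"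
  proof (rule prox_exists[OF pcc])
    fix y r assume "ereal (\<phi> y) \<le> ereal r"
    then have "\<phi> y \<le> r" by simp
    moreover have "\<bar>\<phi> y\<bar> \<le> onorm \<phi> * norm y" using onorm[OF assms, of y] by simp
    \<comment> \<open>Completing the square: \<open>- onorm \<phi> * norm y + (norm y)^2 / 2\<close>
      is at least \<open>- (onorm \<phi>)^2 / 2\<close>, which is the lower bound handed to
      \<open>prox_exists\<close>.\<close>
    moreover have "0 \<le> (norm y - onorm \<phi>)\<^sup>2" by simp
    ultimately show "- (onorm \<phi>)\<^sup>2 / 2 \<le> r + (norm (y - 0))\<^sup>2 / (2 * 1)"
      by (simp add: power2_eq_square algebra_simps)
  qed simp
  then obtain x where "- x \<in> subdifferential (\<lambda>x. ereal (\<phi> x)) x" by auto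
  then have sub: "\<phi> x + inner (- x) (y - x) \<le> \<phi> y" for y by (simp add: subdifferential_def)
  have "\<phi> w = inner (- x) w" for w
    using sub[of "x + w"] sub[of "x - w"] by (simp add: add diff)
  then show ?thesis by blast
qed

text \<open>\<^const>\<open>adjoint\<close> is a choice operator, so its defining property is available only once an
  adjoint is known to exist; on a Hilbert space this is Riesz' theorem.\<close>

lemma bounded_skew_inner:
  fixes F :: "'a::{real_inner, complete_space} \<Rightarrow> 'a"
  assumes "bounded_skew F"
  shows "inner (F x) y = - inner x (F y)"
proof -
  from assms have F: "bounded_linear F" and adj: "adjoint F = (\<lambda>x. - F x)"
    by (auto simp: bounded_skew_def)
  have "\<exists>u. \<forall>x. inner (F x) y = inner u x" for y
    by (rule riesz_representation) (rule bounded_linear_compose[OF bounded_linear_inner_left F, unfolded comp_def])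
  then obtain F' where "inner (F x) y = inner (F' y) x" for x y by metis
  then have "\<forall>x y. inner (F x) y = inner x (F' y)" by (simp add: inner_commute)
  then have "\<forall>x y. inner (F x) y = inner x (adjoint F y)"
    unfolding adjoint_def by (rule someI[where P = "\<lambda>f'. \<forall>x y. inner (F x) y = inner x (f' y)"])
  then show ?thesis by (simp add: adj)
qed

section \<open>Resolvents of subdifferentials with a skew perturbation\<close>

text \<open>The empty operator is not maximal: the operator whose graph is the single point
  \<open>(0, 0)\<close> is monotone and properly extends it.\<close>

lemma subdifferential_nonempty_if_maximal:
  assumes "maximal_monotone (op_plus (subdifferential f) (op_of_fun F))"
  shows "\<exists>x u. u \<in> subdifferential f x"
proof (rule ccontr)
  let ?A = "op_plus (subdifferential f) (op_of_fun F)"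
  assume "\<not> ?thesis"
  then have empty: "?A x = {}" for x by (auto simp: op_plus_def)
  define R :: "'a \<Rightarrow> 'a set" where "R x = (if x = 0 then {0} else {})" for x
  have "monotone_op R" by (auto simp: monotone_op_def R_def)
  then have "R = ?A" using assms empty by (auto simp: maximal_monotone_def)
  then have "R 0 = {}" using empty by simp
  then show False by (simp add: R_def)
qed

text \<open>This takes the place of Minty's theorem. The inclusion is equivalent to \<open>x\<close> being a fixed point
  of a forward-backward map, which is a contraction for a small step \<open>t\<close> because skewness makes
  \<open>x \<mapsto> x + \<gamma> F x\<close> strongly monotone and Lipschitz. A single subgradient provides the affine minorant
  needed for the proximal map to exist.\<close>

lemma skew_resolvent_exists:
  fixes f :: "'a::{real_inner, complete_space} \<Rightarrow> ereal"
  assumes f: "proper_closed_convex f" and u0: "u0 \<in> subdifferential f x0"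
    and F: "bounded_linear F" and skew: "\<And>x. inner (F x) x = 0" and \<gamma>: "\<gamma> > 0"
  shows "\<exists>x. \<exists>u\<in>subdifferential f x. z = x + \<gamma> *\<^sub>R (u + F x)"
proof -
  interpret F: bounded_linear F by fact
  have proper: "proper_fun f" using f by (simp add: proper_closed_convex_def)
  define K where "K = \<gamma> * onorm F"
  \<comment> \<open>This \<open>t\<close> minimises \<open>(1 - t)^2 + t^2 * K^2\<close>, the
    squared contraction factor of the forward step; the minimum is \<open>1 - t\<close>, hence the
    choice of \<open>c\<close>.\<close>
  define t where "t = 1 / (1 + K\<^sup>2)"
  define c where "c = sqrt (1 - t)"
  have K1: "0 < 1 + K\<^sup>2" by (simp add: add_pos_nonneg)
  have t: "0 < t" "t \<le> 1" using K1 by (simp_all add: t_def)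
  have c: "0 \<le> c" "c < 1" "c\<^sup>2 = 1 - t" using t by (simp_all add: c_def)
  \<comment> \<open>With proximal parameter \<open>t * \<gamma>\<close> the step \<open>t\<close>
    cancels in the fixed-point equation of \<open>M\<close>, leaving the inclusion with
    \<open>\<gamma>\<close> alone.\<close>
  define s where "s = t * \<gamma>"
  have s: "s > 0" using t \<gamma> by (simp add: s_def)
  obtain a where a: "f x0 = ereal a"
    using subdifferential_finite[OF proper u0] by (cases "f x0") auto
  have "\<exists>x. (1 / s) *\<^sub>R (v - x) \<in> subdifferential f x" for v
  proof (rule prox_exists[OF f s])
    fix y r assume "f y \<le> ereal r"
    moreover have "f x0 + ereal (inner u0 (y - x0)) \<le> f y" using u0 by (simp add: subdifferential_def)
    ultimately have "f x0 + ereal (inner u0 (y - x0)) \<le> ereal r" by (rule order_trans[rotated])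
    then have r: "a + inner u0 (y - x0) \<le> r" by (simp add: a)
    have "0 \<le> (norm (s *\<^sub>R u0 + (y - v)))\<^sup>2 / (2 * s)" using s by simp
    also have "(norm (s *\<^sub>R u0 + (y - v)))\<^sup>2
        = s * (2 * inner u0 (y - v) + s * (norm u0)\<^sup>2) + (norm (y - v))\<^sup>2"
      by (simp add: power2_norm_eq_inner inner_commute algebra_simps)
    also have "\<dots> / (2 * s) = inner u0 (y - v) + s / 2 * (norm u0)\<^sup>2 + (norm (y - v))\<^sup>2 / (2 * s)"
      using s by (simp add: field_simps)
    finally show "a + inner u0 (v - x0) - s / 2 * (norm u0)\<^sup>2 \<le> r + (norm (y - v))\<^sup>2 / (2 * s)"
      using r by (simp add: inner_diff_right)
  qed
  then obtain P where P: "(1 / s) *\<^sub>R (v - P v) \<in> subdifferential f (P v)" for v by metis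
  \<comment> \<open>Monotonicity of the subdifferential makes \<open>P\<close> firmly nonexpansive;
    Cauchy-Schwarz then gives nonexpansiveness.\<close>
  have P_nonexp: "norm (P v - P w) \<le> norm (v - w)" for v w
  proof -
    have "0 \<le> inner ((1 / s) *\<^sub>R (v - P v) - (1 / s) *\<^sub>R (w - P w)) (P v - P w)"
      by (rule subdifferential_monotone[OF proper P P])
    also have "\<dots> = inner ((1 / s) *\<^sub>R ((v - w) - (P v - P w))) (P v - P w)"
      by (simp add: algebra_simps)
    finally have "0 \<le> inner ((v - w) - (P v - P w)) (P v - P w)" using s by (simp add: zero_le_divide_iff)
    then have "norm (P v - P w) * norm (P v - P w) \<le> inner (v - w) (P v - P w)"
      unfolding inner_diff_left[of "v - w"] power2_norm_eq_inner[symmetric] power2_eq_square by simp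
    also have "\<dots> \<le> norm (v - w) * norm (P v - P w)" by (rule norm_cauchy_schwarz)
    finally show ?thesis by (cases "P v = P w") simp_all
  qed
  define M where "M x = P (x - t *\<^sub>R (x + \<gamma> *\<^sub>R F x - z))" for x
  have "dist (M x) (M y) \<le> c * dist x y" for x y
  proof -
    define w where "w = x - y"
    have "norm (M x - M y) \<le> norm ((1 - t) *\<^sub>R w - (t * \<gamma>) *\<^sub>R F w)"
      using P_nonexp[of "x - t *\<^sub>R (x + \<gamma> *\<^sub>R F x - z)" "y - t *\<^sub>R (y + \<gamma> *\<^sub>R F y - z)"]
      by (simp add: M_def w_def F.diff algebra_simps)
    also have "\<dots> \<le> c * norm w"
    proof (rule power2_le_imp_le)
      have "norm (\<gamma> *\<^sub>R F w) \<le> K * norm w" using onorm[OF F, of w] \<gamma> by (simp add: K_def mult.assoc)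
      then have "(norm (\<gamma> *\<^sub>R F w))\<^sup>2 \<le> (K * norm w)\<^sup>2" by (rule power_mono) simp
      moreover have "(norm ((1 - t) *\<^sub>R w - (t * \<gamma>) *\<^sub>R F w))\<^sup>2
          = (1 - t)\<^sup>2 * (norm w)\<^sup>2 + t\<^sup>2 * (norm (\<gamma> *\<^sub>R F w))\<^sup>2"
        using skew[of w] unfolding power2_norm_eq_inner
        by (simp add: inner_commute inner_diff_left inner_diff_right) (simp add: power2_eq_square)
      ultimately have "(norm ((1 - t) *\<^sub>R w - (t * \<gamma>) *\<^sub>R F w))\<^sup>2
          \<le> (1 - t)\<^sup>2 * (norm w)\<^sup>2 + t\<^sup>2 * (K * norm w)\<^sup>2" by (simp add: mult_left_mono)
      also have "\<dots> = (1 - 2 * t + t * (t * (1 + K\<^sup>2))) * (norm w)\<^sup>2"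
        by (simp add: power2_eq_square algebra_simps)
      also have "t * (1 + K\<^sup>2) = 1" using K1 by (simp add: t_def)
      finally show "(norm ((1 - t) *\<^sub>R w - (t * \<gamma>) *\<^sub>R F w))\<^sup>2 \<le> (c * norm w)\<^sup>2"
        by (simp add: power_mult_distrib c)
    qed (simp add: c)
    finally show ?thesis by (simp add: dist_norm w_def)
  qed
  then obtain x where x: "M x = x" using banach_fix_type[OF c(1,2), of M] by blast
  have "(1 / s) *\<^sub>R (x - t *\<^sub>R (x + \<gamma> *\<^sub>R F x - z) - x) \<in> subdifferential f x"
    using P[of "x - t *\<^sub>R (x + \<gamma> *\<^sub>R F x - z)"] x by (simp add: M_def)
  moreover have "(1 / s) *\<^sub>R (x - t *\<^sub>R (x + \<gamma> *\<^sub>R F x - z) - x) = (1 / \<gamma>) *\<^sub>R (z - x) - F x"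
    using t \<gamma> by (simp add: s_def algebra_simps)
  moreover have "z = x + \<gamma> *\<^sub>R ((1 / \<gamma>) *\<^sub>R (z - x) - F x + F x)" using \<gamma> by simp
  ultimately show ?thesis by metis
qed

text \<open>Two representations of \<open>z\<close> satisfy
  \<open>\<gamma> * (v - u) = -(y - x)\<close>, so monotonicity forces \<open>norm (y - x)\<close>
  to vanish. Thus \<open>the_elem\<close> is applied to a singleton as soon as one solution is
  exhibited.\<close>

lemma resolvent_eqI:
  assumes S: "monotone_op S" and \<gamma>: "\<gamma> > 0" and u: "u \<in> S x" and z: "z = x + \<gamma> *\<^sub>R u"
  shows "resolvent (op_scale \<gamma> S) z = x"
proof -
  have "y = x" if v: "v \<in> S y" "z = y + \<gamma> *\<^sub>R v" for y v
  proof -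
    have "0 \<le> \<gamma> * inner (v - u) (y - x)" using S u v \<gamma> by (auto simp: monotone_op_def)
    also have "\<dots> = inner (\<gamma> *\<^sub>R v - \<gamma> *\<^sub>R u) (y - x)" by (simp add: inner_diff_left algebra_simps)
    also have "\<gamma> *\<^sub>R v - \<gamma> *\<^sub>R u = - (y - x)" using z v by (simp add: algebra_simps)
    finally show ?thesis unfolding inner_minus_left by (metis eq_iff_diff_eq_0 inner_eq_zero_iff inner_ge_zero neg_0_le_iff_le order_antisym)
  qed
  then have "op_inverse (op_plus (op_of_fun id) (op_scale \<gamma> S)) z = {x}"
    using u z by (auto simp: op_inverse_def op_plus_def op_of_fun_def op_scale_def)
  then show ?thesis by (simp add: resolvent_def)
qed

text \<open>Unfolds the choice-based resolvent into a subgradient and an equation, the only form in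
  which resolvents enter the convergence argument.\<close>

lemma resolvent_subdifferential_skew:
  fixes f :: "'a::{real_inner, complete_space} \<Rightarrow> ereal"
  assumes f: "proper_closed_convex f" and F: "bounded_skew F"
    and S: "S = op_plus (subdifferential f) (op_of_fun F)" "maximal_monotone S" and \<gamma>: "\<gamma> > 0"
  shows "\<exists>u\<in>subdifferential f (resolvent (op_scale \<gamma> S) z).
    z = resolvent (op_scale \<gamma> S) z + \<gamma> *\<^sub>R (u + F (resolvent (op_scale \<gamma> S) z))"
proof -
  obtain x0 u0 where "u0 \<in> subdifferential f x0"
    using subdifferential_nonempty_if_maximal S by metis
  moreover have "bounded_linear F" using F by (simp add: bounded_skew_def)
  moreover have "inner (F x) x = 0" for x using bounded_skew_inner[OF F, of x x] by (simp add: inner_commute)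
  ultimately obtain x u where u: "u \<in> subdifferential f x" and z: "z = x + \<gamma> *\<^sub>R (u + F x)"
    using skew_resolvent_exists[OF f _ _ _ \<gamma>] by metis
  have "u + F x \<in> S x" using u by (auto simp: S op_plus_def op_of_fun_def)
  then have "resolvent (op_scale \<gamma> S) z = x"
    using S(2) \<gamma> z by (intro resolvent_eqI) (auto simp: maximal_monotone_def)
  then show ?thesis using u z by auto
qed

section \<open>Cocoercivity of the gradient\<close>

lemma GDERIV_along_line:
  assumes "\<And>x. GDERIV h x :> C x"
  shows "((\<lambda>t. h (x + t *\<^sub>R d)) has_real_derivative inner (C (x + t *\<^sub>R d)) d) (at t)"
proof -
  have 1: "((\<lambda>t. x + t *\<^sub>R d) has_derivative (\<lambda>s. s *\<^sub>R d)) (at t)"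
    by (auto intro!: derivative_eq_intros)
  have 2: "(h has_derivative (\<lambda>k. inner k (C (x + t *\<^sub>R d)))) (at (x + t *\<^sub>R d))"
    using assms by (simp add: gderiv_def)
  show ?thesis unfolding has_field_derivative_def
    by (rule has_derivative_eq_rhs[OF has_derivative_compose[OF 1 2]]) (simp add: fun_eq_iff inner_commute)
qed

lemma convex_gradient_inequality:
  assumes h: "convex_on UNIV h" and C: "\<And>x. GDERIV h x :> C x"
  shows "h x + inner (C x) (y - x) \<le> h y"
proof -
  have "convex_on UNIV (\<lambda>t. h (x + t *\<^sub>R (y - x)))"
  proof (rule convex_onI)
    fix t a b :: real assume t: "0 < t" "t < 1"
    have "x + ((1 - t) *\<^sub>R a + t *\<^sub>R b) *\<^sub>R (y - x)
        = (1 - t) *\<^sub>R (x + a *\<^sub>R (y - x)) + t *\<^sub>R (x + b *\<^sub>R (y - x))"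
      by (simp add: algebra_simps)
    then show "h (x + ((1 - t) *\<^sub>R a + t *\<^sub>R b) *\<^sub>R (y - x))
        \<le> (1 - t) * h (x + a *\<^sub>R (y - x)) + t * h (x + b *\<^sub>R (y - x))"
      using convex_onD[OF h, of t] t by simp
  qed simp
  from convex_on_imp_above_tangent[OF this, of 0 1 "inner (C x) (y - x)"]
  show ?thesis using GDERIV_along_line[OF C, of x "y - x" 0] by simp
qed

text \<open>Subtracting the quadratic upper model from \<open>h\<close> along the segment gives a
  function \<open>\<psi>\<close> whose derivative is nonpositive on \<open>[0, 1]\<close> by the
  Lipschitz bound; the claim compares its two endpoints.\<close>

lemma descent_lemma:
  assumes C: "\<And>x. GDERIV h x :> C x" and L: "L-lipschitz_on UNIV C"
  shows "h y \<le> h x + inner (C x) (y - x) + L / 2 * (norm (y - x))\<^sup>2"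
proof -
  define d where "d = y - x"
  define \<psi> where "\<psi> t = h (x + t *\<^sub>R d) - t * inner (C x) d - L / 2 * t\<^sup>2 * (norm d)\<^sup>2" for t
  have "\<psi> 0 \<ge> \<psi> 1"
  proof (rule DERIV_nonpos_imp_nonincreasing[where f = \<psi>])
    fix t :: real assume t: "0 \<le> t" "t \<le> 1"
    have "(\<psi> has_real_derivative inner (C (x + t *\<^sub>R d)) d - inner (C x) d - L * t * (norm d)\<^sup>2) (at t)"
      unfolding \<psi>_def by (rule derivative_eq_intros GDERIV_along_line[OF C] refl | simp)+
    moreover have "inner (C (x + t *\<^sub>R d) - C x) d \<le> L * t * (norm d)\<^sup>2"
    proof -
      have "norm (C (x + t *\<^sub>R d) - C x) \<le> L * (t * norm d)"
        using lipschitz_onD[OF L, of "x + t *\<^sub>R d" x] t by (simp add: dist_norm)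
      then have "norm (C (x + t *\<^sub>R d) - C x) * norm d \<le> L * (t * norm d) * norm d"
        by (rule mult_right_mono) simp
      then show ?thesis using norm_cauchy_schwarz[of "C (x + t *\<^sub>R d) - C x" d]
        by (simp add: power2_eq_square mult.assoc)
    qed
    ultimately show "\<exists>y. (\<psi> has_real_derivative y) (at t) \<and> y \<le> 0"
      by (auto simp: inner_diff_left)
  qed simp
  then show ?thesis by (simp add: \<psi>_def d_def)
qed

text \<open>The Baillon-Haddad theorem. A gradient inequality improved by a square of the gradient
  difference is added to its copy with \<open>x\<close> and \<open>y\<close> exchanged, which
  cancels the values of \<open>h\<close>.\<close>

lemma gradient_cocoercive:
  assumes h: "convex_on UNIV h" and C: "\<And>x. GDERIV h x :> C x"
    and \<beta>: "\<beta> > 0" and L: "(1 / \<beta>)-lipschitz_on UNIV C"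
  shows "\<beta> * (norm (C x - C y))\<^sup>2 \<le> inner (C x - C y) (x - y)"
proof -
  have *: "h x + inner (C x) (y - x) + \<beta> / 2 * (norm (C y - C x))\<^sup>2 \<le> h y" for x y
  proof -
    define e where "e = C y - C x"
    \<comment> \<open>compare \<open>h\<close> at a gradient step of \<open>h - inner (C x)\<close> taken from \<open>y\<close>\<close>
    have "h x + inner (C x) (y - \<beta> *\<^sub>R e - x) \<le> h (y - \<beta> *\<^sub>R e)"
      by (rule convex_gradient_inequality[OF h C])
    moreover have "h (y - \<beta> *\<^sub>R e) \<le> h y + inner (C y) (y - \<beta> *\<^sub>R e - y) + (1 / \<beta>) / 2 * (norm (y - \<beta> *\<^sub>R e - y))\<^sup>2"
      by (rule descent_lemma[OF C L])
    moreover have "(1 / \<beta>) / 2 * (norm (y - \<beta> *\<^sub>R e - y))\<^sup>2 = \<beta> / 2 * inner e e"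
      using \<beta> by (simp add: power_mult_distrib power2_eq_square dot_square_norm)
    moreover have "inner (C y) (\<beta> *\<^sub>R e) - inner (C x) (\<beta> *\<^sub>R e) = \<beta> * inner e e"
      by (simp add: e_def inner_diff_left algebra_simps)
    ultimately have "h x + inner (C x) (y - x) + \<beta> / 2 * inner e e \<le> h y"
      by (simp add: inner_diff_right)
    then show ?thesis by (simp add: e_def power2_norm_eq_inner)
  qed
  from *[of x y] *[of y x] show ?thesis
    by (simp add: inner_diff_left inner_diff_right norm_minus_commute)
qed

lemma convex_on_UNIV_if_proper_closed_convex:
  assumes "proper_closed_convex (\<lambda>x. ereal (h x))"
  shows "convex_on UNIV h"
proof (rule convex_onI)
  fix t :: real and x y assume t: "0 < t" "t < 1"
  have "(1 - t) *\<^sub>R (x, h x) + t *\<^sub>R (y, h y) \<in> ereal_epigraph (\<lambda>x. ereal (h x))"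
    using assms t by (intro convexD) (auto simp: proper_closed_convex_def ereal_epigraph_def)
  then show "h ((1 - t) *\<^sub>R x + t *\<^sub>R y) \<le> (1 - t) * h x + t * h y"
    by (simp add: ereal_epigraph_def)
qed simp

section \<open>Three-operator splitting\<close>

text \<open>Summation by parts: the difference \<open>a i - a (Suc i)\<close> occurs in exactly the
  \<open>i + 1\<close> telescoping sums for \<open>a j - a (Suc k)\<close> with
  \<open>j \<le> i\<close>.\<close>

lemma weighted_telescoping_sum:
  fixes a :: "nat \<Rightarrow> 'a::real_vector"
  shows "(\<Sum>i=0..k. (real i + 1) *\<^sub>R (a i - a (Suc i))) = (\<Sum>i=0..k. a i - a (Suc k))"
proof (induction k)
  case (Suc k)
  have "(\<Sum>i=0..Suc k. a i - a (Suc (Suc k)))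
      = (\<Sum>i=0..Suc k. (a i - a (Suc k)) + (a (Suc k) - a (Suc (Suc k))))" by simp
  also have "\<dots> = (\<Sum>i=0..Suc k. a i - a (Suc k)) + (\<Sum>i=0..Suc k. a (Suc k) - a (Suc (Suc k)))"
    by (rule sum.distrib)
  also have "(\<Sum>i=0..Suc k. a i - a (Suc k)) = (\<Sum>i=0..k. a i - a (Suc k))" by simp
  also have "(\<Sum>i=0..Suc k. a (Suc k) - a (Suc (Suc k))) = (real (Suc k) + 1) *\<^sub>R (a (Suc k) - a (Suc (Suc k)))"
    unfolding sum_constant_scaleR by simp
  finally show ?case using Suc.IH by simp
qed simp

lemma sum_linear_weights: "(\<Sum>i=0..k. 2 / ((real k + 1) * (real k + 2)) * (real i + 1)) = 1"
proof -
  have "(\<Sum>i=0..k. real i + 1) = (real k + 1) * (real k + 2) / 2"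
    by (induction k) (simp_all add: field_simps)
  then show ?thesis unfolding sum_distrib_left[symmetric] by (simp add: add_nonneg_eq_0_iff)
qed

lemma norm_linear_average_diff_le:
  fixes z :: "nat \<Rightarrow> 'a::real_normed_vector"
  assumes D: "\<And>i. norm (z i - zs) \<le> D"
  shows "norm (\<Sum>i=0..k. (real i + 1) *\<^sub>R (z i - z (Suc i))) \<le> 2 * D * (real k + 1)"
proof -
  have "norm (\<Sum>i=0..k. z i - z (Suc k)) \<le> (\<Sum>i=0..k. 2 * D)"
  proof (rule sum_norm_le)
    fix i
    have "norm ((z i - zs) - (z (Suc k) - zs)) \<le> norm (z i - zs) + norm (z (Suc k) - zs)"
      by (rule norm_triangle_ineq4)
    then show "norm (z i - z (Suc k)) \<le> 2 * D" using D[of i] D[of "Suc k"] by simp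
  qed
  then show ?thesis unfolding weighted_telescoping_sum by (simp add: algebra_simps)
qed

text \<open>The weight \<open>\<epsilon>\<close> falls on the square of \<open>d\<close> and its
  inverse on that of \<open>e\<close>; this is how one \<open>\<epsilon>\<close> limits both the
  relaxation (\<open>lam \<le> 2 - \<epsilon>\<close>) and the step size
  (\<open>\<gamma> < 2 * \<beta> * \<epsilon>\<close>).\<close>

lemma inner_young:
  fixes d e :: "'a::real_inner"
  assumes "\<epsilon> > 0"
  shows "2 * \<gamma> * inner d e \<le> \<epsilon> * inner d d + \<gamma>\<^sup>2 / \<epsilon> * inner e e"
proof -
  have "0 \<le> (norm (\<epsilon> *\<^sub>R d - \<gamma> *\<^sub>R e))\<^sup>2 / \<epsilon>" using assms by simp
  also have "\<dots> = \<epsilon> * inner d d - 2 * \<gamma> * inner d e + \<gamma>\<^sup>2 / \<epsilon> * inner e e"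
    using assms by (simp add: power2_norm_eq_inner inner_commute algebra_simps) (simp add: field_simps power2_eq_square)
  finally show ?thesis by simp
qed

text \<open>The two resolvent inequalities and cocoercivity add up to a lower bound on
  \<open>inner d w\<close>, the linear term in the expansion of \<open>norm (w - lam * d)\<close>
  squared. The one term without a sign, \<open>inner d e\<close>, is split by
  \<open>inner_young\<close>.\<close>

lemma fejer_step:
  fixes z zs xA xB xs c cs :: "'a::real_inner"
  assumes mA: "0 \<le> inner (xA - xs) ((2 *\<^sub>R xB - z - \<gamma> *\<^sub>R c - xA) - (2 *\<^sub>R xs - zs - \<gamma> *\<^sub>R cs - xs))"
    and mB: "0 \<le> inner (xB - xs) ((z - xB) - (zs - xs))"
    and co: "\<beta> * (norm (c - cs))\<^sup>2 \<le> inner (c - cs) (xB - xs)"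
    and pos: "\<gamma> > 0" "\<epsilon> > 0" "lam > 0"
  shows "(norm (z + lam *\<^sub>R (xA - xB) - zs))\<^sup>2 \<le> (norm (z - zs))\<^sup>2
    - lam * (2 - \<epsilon> - lam) * (norm (xB - xA))\<^sup>2 - lam * \<gamma> * (2 * \<beta> - \<gamma> / \<epsilon>) * (norm (c - cs))\<^sup>2"
proof -
  define p q w e d where "p = xA - xs" and "q = xB - xs" and "w = z - zs" and "e = c - cs" and "d = q - p"
  have "(2 *\<^sub>R xB - z - \<gamma> *\<^sub>R c - xA) - (2 *\<^sub>R xs - zs - \<gamma> *\<^sub>R cs - xs) = 2 *\<^sub>R q - w - \<gamma> *\<^sub>R e - p"
    by (simp add: p_def q_def w_def e_def algebra_simps scaleR_2)
  with mA have A: "0 \<le> inner p (2 *\<^sub>R q - w - \<gamma> *\<^sub>R e - p)" by (simp add: p_def)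
  have "(z - xB) - (zs - xs) = w - q" by (simp add: w_def q_def)
  with mB have B: "0 \<le> inner q (w - q)" by (simp add: q_def)
  have C: "\<gamma> * (\<beta> * inner e e) \<le> \<gamma> * inner e q"
    using co pos by (simp add: e_def q_def power2_norm_eq_inner)
  have "inner d d - \<gamma> * inner d e + \<gamma> * \<beta> * inner e e \<le> inner d w"
    using A B C by (simp add: d_def inner_commute algebra_simps)
  then have 1: "2 * lam * (inner d d - \<gamma> * inner d e + \<gamma> * \<beta> * inner e e) \<le> 2 * lam * inner d w"
    using pos by simp
  have 2: "lam * (2 * \<gamma> * inner d e) \<le> lam * (\<epsilon> * inner d d + \<gamma>\<^sup>2 / \<epsilon> * inner e e)"
    using pos by (intro mult_left_mono inner_young) simp_all
  have 3: "xB - xA = d" and "z + lam *\<^sub>R (xA - xB) - zs = w - lam *\<^sub>R d"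
    by (simp_all add: d_def p_def q_def w_def algebra_simps)
  then have "(norm (z + lam *\<^sub>R (xA - xB) - zs))\<^sup>2 = inner w w - 2 * lam * inner d w + lam\<^sup>2 * inner d d"
    by (simp add: power2_norm_eq_inner inner_commute algebra_simps) (simp add: power2_eq_square)
  moreover have "(norm (z - zs))\<^sup>2 = inner w w" "(norm (xB - xA))\<^sup>2 = inner d d" "(norm (c - cs))\<^sup>2 = inner e e"
    by (simp_all add: power2_norm_eq_inner 3 w_def e_def)
  ultimately show ?thesis using 1 2 by (simp add: algebra_simps power2_eq_square)
qed

text \<open>The subgradients are eliminated through the resolvent equations, and skewness reduces
  the operator terms to \<open>inner x (ya + yb)\<close>. Splitting \<open>c\<close> into
  \<open>c - cs\<close> and \<open>cs\<close> separates a part for \<open>inner_young\<close> from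
  one that is linear in \<open>xB - xA\<close> and will telescope.\<close>

lemma objective_step:
  fixes x z xA xB a b c ya yb cs :: "'a::real_inner"
  assumes F: "FA + inner a (x - xA) \<le> Fx" and G: "GB + inner b (x - xB) \<le> Gx"
    and H: "HB + inner c (x - xB) \<le> Hx"
    and zA: "2 *\<^sub>R xB - z - \<gamma> *\<^sub>R c = xA + \<gamma> *\<^sub>R (a + ya)" and zB: "z = xB + \<gamma> *\<^sub>R (b + yb)"
    and skew: "inner ya xA = 0" "inner yb xB = 0"
    and pos: "\<gamma> > 0" "\<epsilon> > 0" "lam > 0"
  shows "2 * \<gamma> * lam * (FA + GB + HB - (Fx + Gx + Hx) - inner x (ya + yb))
    \<le> (norm (z - x))\<^sup>2 - (norm (z + lam *\<^sub>R (xA - xB) - x))\<^sup>2 - lam * (2 - \<epsilon> - lam) * (norm (xB - xA))\<^sup>2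
      + lam * \<gamma>\<^sup>2 / \<epsilon> * (norm (c - cs))\<^sup>2 + 2 * \<gamma> * lam * inner (xB - xA) cs"
proof -
  define p q w e d where "p = xA - x" and "q = xB - x" and "w = z - x" and "e = c - cs" and "d = q - p"
  have ga: "\<gamma> *\<^sub>R a = 2 *\<^sub>R q - w - \<gamma> *\<^sub>R c - p - \<gamma> *\<^sub>R ya"
    using zA by (simp add: p_def q_def w_def algebra_simps scaleR_2)
  have gb: "\<gamma> *\<^sub>R b = w - q - \<gamma> *\<^sub>R yb" using zB by (simp add: q_def w_def algebra_simps)
  have "FA + GB + HB - (Fx + Gx + Hx) \<le> inner a p + inner b q + inner c q"
    using F G H by (simp add: p_def q_def inner_diff_right)
  then have "\<gamma> * (FA + GB + HB - (Fx + Gx + Hx)) \<le> inner (\<gamma> *\<^sub>R a) p + inner (\<gamma> *\<^sub>R b) q + \<gamma> * inner c q"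
    using mult_left_mono[of _ _ \<gamma>] pos by (fastforce simp: algebra_simps)
  moreover have "inner ya p = - inner x ya" "inner yb q = - inner x yb"
    using skew by (simp_all add: p_def q_def inner_diff_right inner_commute)
  ultimately have "\<gamma> * (FA + GB + HB - (Fx + Gx + Hx) - inner x (ya + yb))
      \<le> inner d w - inner d d + \<gamma> * inner d c"
    unfolding ga gb by (simp add: d_def inner_commute algebra_simps)
  also have "inner d c = inner d e + inner d cs" by (simp add: e_def inner_diff_right)
  finally have 1: "2 * lam * (\<gamma> * (FA + GB + HB - (Fx + Gx + Hx) - inner x (ya + yb)))
      \<le> 2 * lam * (inner d w - inner d d + \<gamma> * (inner d e + inner d cs))" using pos by simp
  have 2: "lam * (2 * \<gamma> * inner d e) \<le> lam * (\<epsilon> * inner d d + \<gamma>\<^sup>2 / \<epsilon> * inner e e)"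
    using pos by (intro mult_left_mono inner_young) simp_all
  have 3: "xB - xA = d" and "z + lam *\<^sub>R (xA - xB) - x = w - lam *\<^sub>R d"
    by (simp_all add: d_def p_def q_def w_def algebra_simps)
  then have "(norm (z + lam *\<^sub>R (xA - xB) - x))\<^sup>2 = inner w w - 2 * lam * inner d w + lam\<^sup>2 * inner d d"
    by (simp add: power2_norm_eq_inner inner_commute algebra_simps) (simp add: power2_eq_square)
  moreover have "(norm (z - x))\<^sup>2 = inner w w" "(norm (xB - xA))\<^sup>2 = inner d d" "(norm (c - cs))\<^sup>2 = inner e e"
    by (simp_all add: power2_norm_eq_inner 3 w_def e_def)
  ultimately show ?thesis using 1 2 unfolding 3 by (simp add: algebra_simps power2_eq_square)
qed

theorem corollaryD8:
  fixes f g :: "'a::{real_inner, complete_space} \<Rightarrow> ereal"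
    and h :: "'a \<Rightarrow> real"
    and C Abar Bbar T JA JB :: "'a \<Rightarrow> 'a"
    and A B :: "'a \<Rightarrow> 'a set"
    and \<beta> \<epsilon> \<gamma> \<alpha> lam :: real
    and zstar xstar :: 'a
    and z xA xB xbarA xbarB :: "nat \<Rightarrow> 'a"
  assumes f: "proper_closed_convex f"
    and g: "proper_closed_convex g"
    and h: "proper_closed_convex (\<lambda>x. ereal (h x))"
    and C_gradient: "\<And>x. GDERIV h x :> C x"
    and \<beta>: "\<beta> > 0"
    and C_lipschitz: "(1 / \<beta>)-lipschitz_on UNIV C"
    and Abar: "bounded_skew Abar"
    and Bbar: "bounded_skew Bbar"
    and A_eq: "A = op_plus (subdifferential f) (op_of_fun Abar)"
    and B_eq: "B = op_plus (subdifferential g) (op_of_fun Bbar)"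
    and A_maximal: "maximal_monotone A"
    and B_maximal: "maximal_monotone B"
    and \<epsilon>: "0 < \<epsilon>" "\<epsilon> < 1"
    and \<gamma>: "0 < \<gamma>" "\<gamma> < 2 * \<beta> * \<epsilon>"
    and \<alpha>: "\<alpha> = 1 / (2 - \<epsilon>)"
    and lam: "0 < lam" "lam \<le> 1 / \<alpha>"
    and JA_eq: "JA = resolvent (op_scale \<gamma> A)"
    and JB_eq: "JB = resolvent (op_scale \<gamma> B)"
    and T_eq: "T = (\<lambda>u. u - JB u + JA (2 *\<^sub>R JB u - u - \<gamma> *\<^sub>R C (JB u)))"
    and zstar: "T zstar = zstar"
    and xstar: "xstar = JB zstar"
    and z_Suc: "\<And>k. z (Suc k) = (1 - lam) *\<^sub>R z k + lam *\<^sub>R T (z k)"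
    and xB_eq: "\<And>k. xB k = JB (z k)"
    and xA_eq: "\<And>k. xA k = JA (2 *\<^sub>R xB k - z k - \<gamma> *\<^sub>R C (xB k))"
    and xbarA_eq: "\<And>k. xbarA k =
          (2 / ((real k + 1) * (real k + 2))) *\<^sub>R (\<Sum>i=0..k. (real i + 1) *\<^sub>R xA i)"
    and xbarB_eq: "\<And>k. xbarB k =
          (2 / ((real k + 1) * (real k + 2))) *\<^sub>R (\<Sum>i=0..k. (real i + 1) *\<^sub>R xB i)"
  shows
    "(\<forall>k. \<forall>x \<in> eff_domain f \<inter> eff_domain g.
        f (xbarA k) + g (xbarB k) + ereal (h (xbarB k)) - (f x + g x + ereal (h x))
          + ereal (inner (- x) (Abar (xbarB k) + Bbar (xbarB k)))
        \<le> ereal ((2 * (norm (zstar - x))\<^sup>2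
              + (2 + \<gamma> / (2 * \<beta> * \<epsilon> - \<gamma>)) * (norm (z 0 - zstar))\<^sup>2
              + 10 * \<gamma> * norm (z 0 - zstar) * norm (C xstar)
              + 5 * \<gamma> * onorm Abar * norm x * norm (z 0 - zstar))
            / (\<gamma> * lam * (real k + 1))))
     \<and> (\<forall>Lf. ereal_lipschitz_on Lf (cball xstar ((1 + \<gamma> / \<beta>) * norm (z 0 - zstar))) f \<longrightarrow>
        (\<forall>k. \<forall>x \<in> eff_domain f \<inter> eff_domain g.
          f (xbarB k) + g (xbarB k) + ereal (h (xbarB k)) - (f x + g x + ereal (h x))
            + ereal (inner (- x) (Abar (xbarB k) + Bbar (xbarB k)))
          \<le> ereal ((2 * (norm (zstar - x))\<^sup>2
                + (2 + \<gamma> / (2 * \<beta> * \<epsilon> - \<gamma>)) * (norm (z 0 - zstar))\<^sup>2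
                + 10 * \<gamma> * norm (z 0 - zstar) * norm (C xstar)
                + 5 * \<gamma> * onorm Abar * norm x * norm (z 0 - zstar)
                + 5 * \<gamma> * Lf * norm (z 0 - zstar))
              / (\<gamma> * lam * (real k + 1)))))"
proof -

  \<comment> \<open>Subgradient selections and firm nonexpansiveness of the resolvents\<close>
  have f_proper: "proper_fun f" and g_proper: "proper_fun g"
    using f g by (simp_all add: proper_closed_convex_def)
  have h_convex: "convex_on UNIV h" using h by (rule convex_on_UNIV_if_proper_closed_convex)
  have Abar_lin: "bounded_linear Abar" and Bbar_lin: "bounded_linear Bbar"
    using Abar Bbar by (simp_all add: bounded_skew_def)
  interpret Abar: bounded_linear Abar by fact
  interpret Bbar: bounded_linear Bbar by fact
  have Abar_skew: "inner (Abar u) u = 0" for u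
    using bounded_skew_inner[OF Abar, of u u] by (simp add: inner_commute)
  have Bbar_skew: "inner (Bbar u) u = 0" for u
    using bounded_skew_inner[OF Bbar, of u u] by (simp add: inner_commute)
  have "\<forall>v. \<exists>a\<in>subdifferential f (JA v). v = JA v + \<gamma> *\<^sub>R (a + Abar (JA v))"
    using resolvent_subdifferential_skew[OF f Abar A_eq A_maximal \<gamma>(1)] by (simp add: JA_eq)
  then obtain SA where SA: "SA v \<in> subdifferential f (JA v)"
    and JA: "v = JA v + \<gamma> *\<^sub>R (SA v + Abar (JA v))" for v by metis
  have "\<forall>v. \<exists>b\<in>subdifferential g (JB v). v = JB v + \<gamma> *\<^sub>R (b + Bbar (JB v))"
    using resolvent_subdifferential_skew[OF g Bbar B_eq B_maximal \<gamma>(1)] by (simp add: JB_eq)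
  then obtain SB where SB: "SB v \<in> subdifferential g (JB v)"
    and JB: "v = JB v + \<gamma> *\<^sub>R (SB v + Bbar (JB v))" for v by metis
  \<comment> \<open>Proved once for both resolvents: the subdifferential contributes a nonnegative
    term and the skew map contributes zero.\<close>
  have mono: "0 \<le> inner (J v - J w) ((v - J v) - (w - J w))"
    if \<phi>: "proper_fun \<phi>" and F: "bounded_linear F" "\<And>u. inner (F u) u = 0"
      and S: "\<And>v. S v \<in> subdifferential \<phi> (J v)" and J: "\<And>v. v = J v + \<gamma> *\<^sub>R (S v + F (J v))"
    for \<phi> :: "'a \<Rightarrow> ereal" and F S J :: "'a \<Rightarrow> 'a" and v w
  proof -
    interpret F: bounded_linear F by fact
    have J': "v - J v = \<gamma> *\<^sub>R (S v + F (J v))" for v using J[of v] by (simp add: algebra_simps)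
    have "(v - J v) - (w - J w) = \<gamma> *\<^sub>R ((S v - S w) + F (J v - J w))"
      unfolding J' by (simp add: F.diff algebra_simps)
    then have "inner (J v - J w) ((v - J v) - (w - J w))
        = \<gamma> * (inner (S v - S w) (J v - J w) + inner (F (J v - J w)) (J v - J w))"
      by (simp add: inner_add_right inner_commute)
    then show ?thesis using subdifferential_monotone[OF \<phi> S S, of v w] F(2)[of "J v - J w"] \<gamma>(1) by simp
  qed
  note JA_mono = mono[OF f_proper Abar_lin Abar_skew SA JA]
  note JB_mono = mono[OF g_proper Bbar_lin Bbar_skew SB JB]

  \<comment> \<open>Fejer monotonicity of the iterates\<close>
  define yA where "yA k = 2 *\<^sub>R xB k - z k - \<gamma> *\<^sub>R C (xB k)" for k
  define ys where "ys = 2 *\<^sub>R xstar - zstar - \<gamma> *\<^sub>R C xstar"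
  have xA_JA: "xA k = JA (yA k)" for k by (simp add: xA_eq yA_def)
  \<comment> \<open>The fixed-point equation for \<open>T\<close> says precisely that both
    resolvents return \<open>xstar\<close>.\<close>
  have JA_ys: "JA ys = xstar" using zstar unfolding T_eq by (simp add: ys_def xstar)
  have z_step: "z (Suc k) = z k + lam *\<^sub>R (xA k - xB k)" for k
    unfolding z_Suc T_eq xA_eq xB_eq by (simp add: algebra_simps)
  have lam': "lam \<le> 2 - \<epsilon>" using lam by (simp add: \<alpha>)
  have cocoercive: "\<beta> * (norm (C (xB k) - C xstar))\<^sup>2 \<le> inner (C (xB k) - C xstar) (xB k - xstar)" for k
    by (rule gradient_cocoercive[OF h_convex C_gradient \<beta> C_lipschitz])
  \<comment> \<open>Chosen so that \<open>\<kappa> * (2 * \<beta> - \<gamma> / \<epsilon>) =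
    \<gamma> / \<epsilon>\<close>: then \<open>\<kappa>\<close> times the Fejer decrease pays
    exactly for the gradient square left over in \<open>objective_step\<close>.\<close>
  define \<kappa> where "\<kappa> = \<gamma> / (2 * \<beta> * \<epsilon> - \<gamma>)"
  define D where "D = norm (z 0 - zstar)"
  have D: "0 \<le> D" by (simp add: D_def)
  have \<kappa>: "0 \<le> \<kappa>" using \<gamma> by (simp add: \<kappa>_def)
  have fejer: "lam * (2 - \<epsilon> - lam) * (norm (xB k - xA k))\<^sup>2
      + lam * \<gamma> * (2 * \<beta> - \<gamma> / \<epsilon>) * (norm (C (xB k) - C xstar))\<^sup>2
      \<le> (norm (z k - zstar))\<^sup>2 - (norm (z (Suc k) - zstar))\<^sup>2" for k
  proof -
    have mA: "0 \<le> inner (xA k - xstar) ((2 *\<^sub>R xB k - z k - \<gamma> *\<^sub>R C (xB k) - xA k)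
        - (2 *\<^sub>R xstar - zstar - \<gamma> *\<^sub>R C xstar - xstar))"
      using JA_mono[of "yA k" ys] unfolding JA_ys xA_JA[symmetric] unfolding yA_def ys_def .
    have mB: "0 \<le> inner (xB k - xstar) ((z k - xB k) - (zstar - xstar))"
      using JB_mono[of "z k" zstar] by (simp add: xB_eq xstar)
    show ?thesis
      using fejer_step[OF mA mB cocoercive \<gamma>(1) \<epsilon>(1) lam(1)] by (simp add: z_step)
  qed
  have dist_sum_nonneg: "0 \<le> lam * (2 - \<epsilon> - lam) * (norm (xB k - xA k))\<^sup>2" for k
    using lam lam' by simp
  have coef: "0 < 2 * \<beta> - \<gamma> / \<epsilon>" using \<gamma> \<epsilon> by (simp add: field_simps)
  have C_step: "lam * \<gamma>\<^sup>2 / \<epsilon> * (norm (C (xB k) - C xstar))\<^sup>2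
      \<le> \<kappa> * ((norm (z k - zstar))\<^sup>2 - (norm (z (Suc k) - zstar))\<^sup>2)" for k
  proof -
    have "\<kappa> * (lam * \<gamma> * (2 * \<beta> - \<gamma> / \<epsilon>) * (norm (C (xB k) - C xstar))\<^sup>2)
        \<le> \<kappa> * ((norm (z k - zstar))\<^sup>2 - (norm (z (Suc k) - zstar))\<^sup>2)"
      using fejer[of k] dist_sum_nonneg[of k] \<kappa> by (intro mult_left_mono) linarith+
    moreover have "\<kappa> * (2 * \<beta> - \<gamma> / \<epsilon>) = \<gamma> / \<epsilon>" using \<gamma> \<epsilon> by (simp add: \<kappa>_def field_simps)
    then have "(\<kappa> * (2 * \<beta> - \<gamma> / \<epsilon>)) * (lam * \<gamma> * (norm (C (xB k) - C xstar))\<^sup>2)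
        = lam * \<gamma>\<^sup>2 / \<epsilon> * (norm (C (xB k) - C xstar))\<^sup>2"
      by (simp add: power2_eq_square)
    then have "\<kappa> * (lam * \<gamma> * (2 * \<beta> - \<gamma> / \<epsilon>) * (norm (C (xB k) - C xstar))\<^sup>2)
        = lam * \<gamma>\<^sup>2 / \<epsilon> * (norm (C (xB k) - C xstar))\<^sup>2"
      by (simp only: mult_ac)
    ultimately show ?thesis by simp
  qed
  have z_decreasing: "norm (z (Suc k) - zstar) \<le> norm (z k - zstar)" for k
  proof (rule power2_le_imp_le)
    have "0 \<le> lam * \<gamma> * (2 * \<beta> - \<gamma> / \<epsilon>) * (norm (C (xB k) - C xstar))\<^sup>2"
      using lam \<gamma> coef by simp
    then show "(norm (z (Suc k) - zstar))\<^sup>2 \<le> (norm (z k - zstar))\<^sup>2"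
      using fejer[of k] dist_sum_nonneg[of k] by linarith
  qed simp
  have z_bound: "norm (z k - zstar) \<le> D" for k
    by (induction k) (use z_decreasing order_trans in \<open>auto simp: D_def\<close>)

  \<comment> \<open>Weighted averages and Jensen's inequality\<close>
  have xA_dom: "xA k \<in> eff_domain f" for k
    unfolding xA_JA by (rule subdifferential_in_domain[OF f_proper SA])
  have xB_dom: "xB k \<in> eff_domain g" for k
    unfolding xB_eq by (rule subdifferential_in_domain[OF g_proper SB])
  define fr gr where "fr u = real_of_ereal (f u)" and "gr u = real_of_ereal (g u)" for u
  define W where "W k = 2 / ((real k + 1) * (real k + 2))" for k :: nat
  have W: "0 \<le> W k" for k by (simp add: W_def)
  have W_sum: "(\<Sum>i=0..k. W k * (real i + 1)) = 1" for k
    unfolding W_def by (rule sum_linear_weights)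
  have xbarA: "xbarA k = (\<Sum>i=0..k. (W k * (real i + 1)) *\<^sub>R xA i)" for k
    by (simp add: xbarA_eq W_def scaleR_sum_right)
  have xbarB: "xbarB k = (\<Sum>i=0..k. (W k * (real i + 1)) *\<^sub>R xB i)" for k
    by (simp add: xbarB_eq W_def scaleR_sum_right)
  have f_jensen: "f (xbarA k) \<le> ereal (\<Sum>i=0..k. W k * (real i + 1) * fr (xA i))" for k
    unfolding xbarA fr_def by (rule jensen_ereal[OF f]) (use W W_sum xA_dom in auto)
  have g_jensen: "g (xbarB k) \<le> ereal (\<Sum>i=0..k. W k * (real i + 1) * gr (xB i))" for k
    unfolding xbarB gr_def by (rule jensen_ereal[OF g]) (use W W_sum xB_dom in auto)
  have h_jensen: "h (xbarB k) \<le> (\<Sum>i=0..k. W k * (real i + 1) * h (xB i))" for k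
    using jensen_ereal[OF h, of "{0..k}" "\<lambda>i. W k * (real i + 1)" xB] W W_sum
    by (simp add: xbarB eff_domain_def)

  \<comment> \<open>Here \<open>xB i - xA i\<close> is \<open>z i - z (Suc i)\<close> divided by
    \<open>lam\<close>, so the weighted sum is at most \<open>2 * D * (k + 1) / lam\<close>;
    multiplying by \<open>W k\<close> leaves \<open>k + 2\<close> in the denominator, relaxed to
    \<open>k + 1\<close>.\<close>
  have xbar_dist: "norm (xbarB k - xbarA k) \<le> 4 * D / (lam * (real k + 1))" for k
  proof -
    have "xB i - xA i = (1 / lam) *\<^sub>R (z i - z (Suc i))" for i
      using lam by (simp add: z_step algebra_simps)
    then have "xbarB k - xbarA k = (W k / lam) *\<^sub>R (\<Sum>i=0..k. (real i + 1) *\<^sub>R (z i - z (Suc i)))"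
      unfolding xbarA xbarB sum_subtractf[symmetric] scaleR_diff_right[symmetric]
      by (simp add: scaleR_sum_right mult.commute)
    then have "norm (xbarB k - xbarA k) = W k / lam * norm (\<Sum>i=0..k. (real i + 1) *\<^sub>R (z i - z (Suc i)))"
      using W[of k] lam by simp
    also have "\<dots> \<le> W k / lam * (2 * D * (real k + 1))"
      by (rule mult_left_mono[OF norm_linear_average_diff_le[OF z_bound]]) (use W[of k] lam in simp)
    also have "\<dots> = 4 * D / (lam * (real k + 2))"
      by (simp add: W_def divide_simps)
    also have "\<dots> \<le> 4 * D / (lam * (real k + 1))"
      using D lam by (intro divide_left_mono mult_left_mono) simp_all
    finally show ?thesis .
  qed

  \<comment> \<open>Ergodic bound on the averaged objective gaps\<close>
  define E where "E x = 2 * (norm (zstar - x))\<^sup>2 + (2 + \<kappa>) * D\<^sup>2" for x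
  have ergodic: "(\<Sum>i=0..k. W k * (real i + 1) * (fr (xA i) + gr (xB i) + h (xB i) - (fr x + gr x + h x)
        - inner x (Abar (xA i) + Bbar (xB i))))
      \<le> (E x + 4 * \<gamma> * D * norm (C xstar)) / (\<gamma> * lam * (real k + 1))"
    if x: "x \<in> eff_domain f" "x \<in> eff_domain g" for k x
  proof -
    define Q where "Q i = fr (xA i) + gr (xB i) + h (xB i) - (fr x + gr x + h x)
        - inner x (Abar (xA i) + Bbar (xB i))" for i
    \<comment> \<open>Lyapunov function: the part weighted by \<open>\<kappa>\<close> absorbs the
      gradient square by \<open>C_step\<close>, so that each step bound consists of telescoping
      differences.\<close>
    define V where "V i = (norm (z i - x))\<^sup>2 + \<kappa> * (norm (z i - zstar))\<^sup>2" for i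
    have step: "2 * \<gamma> * lam * Q i \<le> (V i - V (Suc i)) + 2 * \<gamma> * inner (z i - z (Suc i)) (C xstar)" for i
    proof -
      have "2 * \<gamma> * lam * Q i \<le> (norm (z i - x))\<^sup>2 - (norm (z i + lam *\<^sub>R (xA i - xB i) - x))\<^sup>2
          - lam * (2 - \<epsilon> - lam) * (norm (xB i - xA i))\<^sup>2
          + lam * \<gamma>\<^sup>2 / \<epsilon> * (norm (C (xB i) - C xstar))\<^sup>2 + 2 * \<gamma> * lam * inner (xB i - xA i) (C xstar)"
        unfolding Q_def
      proof (rule objective_step)
        show "fr (xA i) + inner (SA (yA i)) (x - xA i) \<le> fr x"
          unfolding fr_def xA_JA by (rule subgradient_inequality[OF f_proper SA x(1)])
        show "gr (xB i) + inner (SB (z i)) (x - xB i) \<le> gr x"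
          unfolding gr_def xB_eq by (rule subgradient_inequality[OF g_proper SB x(2)])
        show "h (xB i) + inner (C (xB i)) (x - xB i) \<le> h x"
          by (rule convex_gradient_inequality[OF h_convex C_gradient])
        show "2 *\<^sub>R xB i - z i - \<gamma> *\<^sub>R C (xB i) = xA i + \<gamma> *\<^sub>R (SA (yA i) + Abar (xA i))"
          using JA[of "yA i"] by (simp add: xA_JA[symmetric]) (simp add: yA_def)
        show "z i = xB i + \<gamma> *\<^sub>R (SB (z i) + Bbar (xB i))"
          unfolding xB_eq by (rule JB)
      qed (use Abar_skew Bbar_skew \<gamma> \<epsilon> lam in auto)
      moreover have "lam * inner (xB i - xA i) (C xstar) = inner (z i - z (Suc i)) (C xstar)"
        by (simp add: z_step inner_diff_left algebra_simps)
      ultimately show ?thesis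
        using C_step[of i] dist_sum_nonneg[of i]
        by (simp add: V_def z_step[symmetric] right_diff_distrib mult.assoc)
    qed
    have "2 * \<gamma> * lam * (\<Sum>i=0..k. (real i + 1) * Q i) = (\<Sum>i=0..k. (real i + 1) * (2 * \<gamma> * lam * Q i))"
      by (simp add: sum_distrib_left mult_ac)
    also have "\<dots> \<le> (\<Sum>i=0..k. (real i + 1) * ((V i - V (Suc i)) + 2 * \<gamma> * inner (z i - z (Suc i)) (C xstar)))"
      by (intro sum_mono mult_left_mono step) simp
    also have "\<dots> = (\<Sum>i=0..k. (real i + 1) *\<^sub>R (V i - V (Suc i)))
        + 2 * \<gamma> * inner (\<Sum>i=0..k. (real i + 1) *\<^sub>R (z i - z (Suc i))) (C xstar)"
      unfolding inner_sum_left sum_distrib_left sum.distrib[symmetric]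
      by (intro sum.cong refl) (simp add: distrib_left mult_ac)
    also have "(\<Sum>i=0..k. (real i + 1) *\<^sub>R (V i - V (Suc i))) \<le> (real k + 1) * E x"
    proof -
      have V: "V i \<le> E x" for i
      proof -
        have "norm (z i - x) \<le> norm (z i - zstar) + norm (zstar - x)" by (rule norm_diff_triangle_ineq[of "z i" zstar zstar x, simplified])
        then have "norm (z i - x) \<le> D + norm (zstar - x)" using z_bound[of i] by simp
        then have "(norm (z i - x))\<^sup>2 \<le> (D + norm (zstar - x))\<^sup>2" by (rule power_mono) simp
        also have "\<dots> \<le> 2 * D\<^sup>2 + 2 * (norm (zstar - x))\<^sup>2"
          using zero_le_power2[of "D - norm (zstar - x)"] by (simp add: power2_eq_square algebra_simps)
        finally have "(norm (z i - x))\<^sup>2 \<le> 2 * D\<^sup>2 + 2 * (norm (zstar - x))\<^sup>2" .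
        moreover have "\<kappa> * (norm (z i - zstar))\<^sup>2 \<le> \<kappa> * D\<^sup>2"
          using \<kappa> z_bound by (intro mult_left_mono power_mono) simp_all
        ultimately show ?thesis by (simp add: V_def E_def algebra_simps)
      qed
      \<comment> \<open>Nonnegativity allows the subtracted \<open>V (Suc k)\<close> to be dropped,
        so every summand is at most \<open>E x\<close>.\<close>
      have V0: "0 \<le> V i" for i using \<kappa> by (simp add: V_def)
      have "(\<Sum>i=0..k. V i - V (Suc k)) \<le> (\<Sum>i=0..k. E x)"
        by (intro sum_mono) (use V V0 in \<open>smt (verit)\<close>)
      then show ?thesis unfolding weighted_telescoping_sum by (simp add: algebra_simps)
    qed
    also have "inner (\<Sum>i=0..k. (real i + 1) *\<^sub>R (z i - z (Suc i))) (C xstar)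
        \<le> (2 * D * (real k + 1)) * norm (C xstar)"
      by (rule order_trans[OF norm_cauchy_schwarz mult_right_mono[OF norm_linear_average_diff_le[OF z_bound]]]) simp
    finally have main: "2 * \<gamma> * lam * (\<Sum>i=0..k. (real i + 1) * Q i)
        \<le> (real k + 1) * (E x + 4 * \<gamma> * D * norm (C xstar))"
      using \<gamma> by (simp add: algebra_simps)
    have E0: "0 \<le> E x + 4 * \<gamma> * D * norm (C xstar)" using \<kappa> D \<gamma> by (simp add: E_def)
    have "(\<Sum>i=0..k. W k * (real i + 1) * Q i) = W k / (2 * \<gamma> * lam) * (2 * \<gamma> * lam * (\<Sum>i=0..k. (real i + 1) * Q i))"
      using \<gamma> lam by (simp add: sum_distrib_left mult.assoc)
    also have "\<dots> \<le> W k / (2 * \<gamma> * lam) * ((real k + 1) * (E x + 4 * \<gamma> * D * norm (C xstar)))"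
      using main W[of k] \<gamma> lam by (intro mult_left_mono) simp_all
    also have "\<dots> = (E x + 4 * \<gamma> * D * norm (C xstar)) / (\<gamma> * lam * (real k + 2))"
      by (simp add: W_def divide_simps)
    also have "\<dots> \<le> (E x + 4 * \<gamma> * D * norm (C xstar)) / (\<gamma> * lam * (real k + 1))"
      using E0 \<gamma> lam by (intro divide_left_mono mult_left_mono) simp_all
    finally show ?thesis by (simp add: Q_def)
  qed

  \<comment> \<open>Moving the skew term to a common average\<close>
  define R where "R x = E x + 10 * \<gamma> * D * norm (C xstar) + 5 * \<gamma> * onorm Abar * norm x * D" for x
  have bound: "(\<Sum>i=0..k. W k * (real i + 1) * fr (xA i)) + (\<Sum>i=0..k. W k * (real i + 1) * gr (xB i))
        + h (xbarB k) - (fr x + gr x + h x) + inner (- x) (Abar (xbarB k) + Bbar (xbarB k))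
      \<le> R x / (\<gamma> * lam * (real k + 1))"
    if x: "x \<in> eff_domain f" "x \<in> eff_domain g" for k x
  proof -
    define w where "w i = W k * (real i + 1)" for i :: nat
    have const: "(\<Sum>i=0..k. w i * a) = a" for a
      using W_sum[of k] by (simp add: w_def sum_distrib_right[symmetric])
    have "(\<Sum>i=0..k. W k * (real i + 1) * (fr (xA i) + gr (xB i) + h (xB i) - (fr x + gr x + h x)
        - inner x (Abar (xA i) + Bbar (xB i))))
      = (\<Sum>i=0..k. W k * (real i + 1) * fr (xA i)) + (\<Sum>i=0..k. W k * (real i + 1) * gr (xB i))
        + (\<Sum>i=0..k. W k * (real i + 1) * h (xB i)) - (fr x + gr x + h x)
        - inner x (Abar (xbarA k) + Bbar (xbarB k))"
      unfolding xbarA xbarB w_def[symmetric] unfolding right_diff_distrib distrib_left sum.distrib sum_subtractf const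
      by (simp add: Abar.sum Bbar.sum Abar.scaleR Bbar.scaleR inner_sum_right inner_add_right distrib_left
          sum.distrib)
    then have 1: "(\<Sum>i=0..k. W k * (real i + 1) * fr (xA i)) + (\<Sum>i=0..k. W k * (real i + 1) * gr (xB i))
        + h (xbarB k) - (fr x + gr x + h x) - inner x (Abar (xbarA k) + Bbar (xbarB k))
      \<le> (E x + 4 * \<gamma> * D * norm (C xstar)) / (\<gamma> * lam * (real k + 1))"
      using ergodic[OF x, of k] h_jensen[of k] by linarith
    \<comment> \<open>The ergodic bound has \<open>Abar\<close> at \<open>xbarA k\<close>; the
      exchange with \<open>xbarB k\<close> costs the operator norm times the distance of the
      averages.\<close>
    have "- inner x (Abar (xbarB k - xbarA k)) \<le> norm x * norm (Abar (xbarB k - xbarA k))"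
      using norm_cauchy_schwarz[of "- x"] by simp
    also have "\<dots> \<le> norm x * (onorm Abar * (4 * D / (lam * (real k + 1))))"
      by (rule mult_left_mono[OF order_trans[OF onorm[OF Abar_lin] mult_left_mono[OF xbar_dist onorm_pos_le[OF Abar_lin]]]]) simp
    also have "\<dots> = (4 * \<gamma> * onorm Abar * norm x * D) / (\<gamma> * lam * (real k + 1))"
      using \<gamma> by simp
    finally have 2: "- inner x (Abar (xbarB k - xbarA k))
        \<le> (4 * \<gamma> * onorm Abar * norm x * D) / (\<gamma> * lam * (real k + 1))" .
    \<comment> \<open>The estimates produce the factor 4 in both error terms; \<open>R\<close>
      carries the larger factors 10 and 5 of the statement.\<close>
    have "(E x + 4 * \<gamma> * D * norm (C xstar) + 4 * \<gamma> * onorm Abar * norm x * D) / (\<gamma> * lam * (real k + 1))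
        \<le> R x / (\<gamma> * lam * (real k + 1))"
      using \<gamma> lam D onorm_pos_le[OF Abar_lin] unfolding R_def
      by (intro divide_right_mono add_mono mult_right_mono) simp_all
    with 1 2 show ?thesis
      by (simp add: Abar.diff inner_diff_right inner_add_right add_divide_distrib)
  qed
  have R_eq: "R x = 2 * (norm (zstar - x))\<^sup>2 + (2 + \<gamma> / (2 * \<beta> * \<epsilon> - \<gamma>)) * (norm (z 0 - zstar))\<^sup>2
      + 10 * \<gamma> * norm (z 0 - zstar) * norm (C xstar) + 5 * \<gamma> * onorm Abar * norm x * norm (z 0 - zstar)" for x
    by (simp add: R_def E_def D_def \<kappa>_def)
  have real_f: "f u = ereal (fr u)" if "\<bar>f u\<bar> \<noteq> \<infinity>" for u
    using that by (auto simp: fr_def ereal_real)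
  have real_g: "g u = ereal (gr u)" if "\<bar>g u\<bar> \<noteq> \<infinity>" for u
    using that by (auto simp: gr_def ereal_real)
  \<comment> \<open>The finite Jensen bound makes the value at the average finite, so the
    extended-real claim reduces to the real inequality.\<close>
  have f_fin: "f (xbarA k) = ereal (fr (xbarA k))" for k
    using f_jensen[of k] by (intro real_f eff_domain_finite[OF f_proper]) (auto simp: eff_domain_def)
  have g_fin: "g (xbarB k) = ereal (gr (xbarB k))" for k
    using g_jensen[of k] by (intro real_g eff_domain_finite[OF g_proper]) (auto simp: eff_domain_def)
  have bound_bar: "fr (xbarA k) + gr (xbarB k) + h (xbarB k) - (fr x + gr x + h x)
        + inner (- x) (Abar (xbarB k) + Bbar (xbarB k)) \<le> R x / (\<gamma> * lam * (real k + 1))"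
    if "x \<in> eff_domain f" "x \<in> eff_domain g" for k x
    using bound[OF that, of k] f_jensen[of k] g_jensen[of k] by (simp add: f_fin g_fin)

  \<comment> \<open>The first inequality\<close>
  have part1: "f (xbarA k) + g (xbarB k) + ereal (h (xbarB k)) - (f x + g x + ereal (h x))
      + ereal (inner (- x) (Abar (xbarB k) + Bbar (xbarB k))) \<le> ereal (R x / (\<gamma> * lam * (real k + 1)))"
    if x: "x \<in> eff_domain f" "x \<in> eff_domain g" for k x
    using bound_bar[OF x, of k]
    by (simp add: f_fin g_fin real_f[OF eff_domain_finite[OF f_proper x(1)]] real_g[OF eff_domain_finite[OF g_proper x(2)]])

  \<comment> \<open>Localisation of the iterates in the ball\<close>
  have JB_close: "norm (JB (z k) - xstar) \<le> D" for k
  proof -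
    have "(norm (JB (z k) - xstar))\<^sup>2 \<le> inner (JB (z k) - xstar) (z k - zstar)"
      using JB_mono[of "z k" zstar] by (simp add: xstar power2_norm_eq_inner inner_diff_right algebra_simps)
    also have "\<dots> \<le> norm (JB (z k) - xstar) * norm (z k - zstar)" by (rule norm_cauchy_schwarz)
    finally have "norm (JB (z k) - xstar) \<le> norm (z k - zstar)"
      by (cases "JB (z k) = xstar") (simp_all add: power2_eq_square)
    then show ?thesis using z_bound[of k] by simp
  qed
  \<comment> \<open>The reflected resolvent accounts for one \<open>D\<close> and the Lipschitz
    gradient step for \<open>\<gamma> / \<beta> * D\<close>.\<close>
  define r where "r = (1 + \<gamma> / \<beta>) * D"
  have "D \<le> r" using D \<gamma> \<beta> by (simp add: r_def algebra_simps)
  then have xB_ball: "xB k \<in> cball xstar r" for k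
    using JB_close[of k] by (simp add: xB_eq dist_norm norm_minus_commute)
  have xA_ball: "xA k \<in> cball xstar r" for k
  proof -
    define q w where "q = xB k - xstar" and "w = z k - zstar"
    have "(norm (xA k - xstar))\<^sup>2 \<le> inner (xA k - xstar) (yA k - ys)"
      using JA_mono[of "yA k" ys] by (simp add: JA_ys xA_JA[symmetric] power2_norm_eq_inner inner_diff_right algebra_simps)
    also have "\<dots> \<le> norm (xA k - xstar) * norm (yA k - ys)" by (rule norm_cauchy_schwarz)
    finally have "norm (xA k - xstar) \<le> norm (yA k - ys)"
      by (cases "xA k = xstar") (simp_all add: power2_eq_square)
    also have "yA k - ys = (2 *\<^sub>R q - w) - \<gamma> *\<^sub>R (C (xB k) - C xstar)"
      by (simp add: yA_def ys_def q_def w_def algebra_simps)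
    also have "norm \<dots> \<le> norm (2 *\<^sub>R q - w) + norm (\<gamma> *\<^sub>R (C (xB k) - C xstar))"
      by (rule norm_triangle_ineq4)
    \<comment> \<open>The squared norm of the reflection equals that of \<open>w\<close> minus
      \<open>4 * inner q (w - q)\<close>, which is nonnegative by firm nonexpansiveness.\<close>
    also have "norm (2 *\<^sub>R q - w) \<le> norm w"
    proof (rule power2_le_imp_le)
      have "0 \<le> inner q (w - q)"
        using JB_mono[of "z k" zstar] by (simp add: q_def w_def xB_eq xstar algebra_simps)
      then show "(norm (2 *\<^sub>R q - w))\<^sup>2 \<le> (norm w)\<^sup>2"
        by (simp add: power2_norm_eq_inner inner_commute inner_diff_left inner_diff_right)
    qed simp
    also have "norm w \<le> D" unfolding w_def by (rule z_bound)
    also have "norm (\<gamma> *\<^sub>R (C (xB k) - C xstar)) \<le> \<gamma> * (1 / \<beta> * D)"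
    proof -
      have "norm (C (xB k) - C xstar) \<le> 1 / \<beta> * norm (xB k - xstar)"
        using lipschitz_onD[OF C_lipschitz] by (simp add: dist_norm)
      also have "\<dots> \<le> 1 / \<beta> * D" using JB_close[of k] \<beta> by (intro mult_left_mono) (simp_all add: xB_eq)
      finally have "\<gamma> * norm (C (xB k) - C xstar) \<le> \<gamma> * (1 / \<beta> * D)"
        using \<gamma> by (intro mult_left_mono) simp_all
      then show ?thesis using \<gamma> by simp
    qed
    finally show ?thesis by (simp add: r_def dist_norm norm_minus_commute algebra_simps)
  qed

  \<comment> \<open>The second inequality\<close>
  have part2: "f (xbarB k) + g (xbarB k) + ereal (h (xbarB k)) - (f x + g x + ereal (h x))
      + ereal (inner (- x) (Abar (xbarB k) + Bbar (xbarB k)))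
      \<le> ereal ((R x + 5 * \<gamma> * Lf * D) / (\<gamma> * lam * (real k + 1)))"
    if L: "ereal_lipschitz_on Lf (cball xstar r) f" and x: "x \<in> eff_domain f" "x \<in> eff_domain g" for k x Lf
  proof -
    have Lip: "Lf-lipschitz_on (cball xstar r) fr"
      using L by (simp add: ereal_lipschitz_on_def fr_def[abs_def])
    have ball: "xbarA k \<in> cball xstar r" "xbarB k \<in> cball xstar r"
      \<comment> \<open>Convexity of the ball carries both averages into the region where
        \<open>f\<close> is finite and Lipschitz, so \<open>f\<close> can be moved from
        \<open>xbarA k\<close> to \<open>xbarB k\<close>.\<close>
      unfolding xbarA xbarB using W W_sum xA_ball xB_ball by (intro convex_sum convex_cball; simp)+
    have f_B: "f (xbarB k) = ereal (fr (xbarB k))"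
      using L ball by (intro real_f) (simp add: ereal_lipschitz_on_def)
    have L0: "0 \<le> Lf" by (rule lipschitz_on_nonneg[OF Lip])
    have "fr (xbarB k) - fr (xbarA k) \<le> Lf * norm (xbarB k - xbarA k)"
      using lipschitz_onD[OF Lip ball(2,1)] by (simp add: dist_norm)
    also have "\<dots> \<le> Lf * (4 * D / (lam * (real k + 1)))"
      by (intro mult_left_mono xbar_dist L0)
    also have "\<dots> = (4 * \<gamma> * Lf * D) / (\<gamma> * lam * (real k + 1))" using \<gamma> by simp
    also have "\<dots> \<le> (5 * \<gamma> * Lf * D) / (\<gamma> * lam * (real k + 1))"
      using \<gamma> lam D L0 by (intro divide_right_mono mult_right_mono) simp_all
    finally have "fr (xbarB k) + gr (xbarB k) + h (xbarB k) - (fr x + gr x + h x)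
        + inner (- x) (Abar (xbarB k) + Bbar (xbarB k)) \<le> (R x + 5 * \<gamma> * Lf * D) / (\<gamma> * lam * (real k + 1))"
      using bound_bar[OF x, of k] unfolding add_divide_distrib by linarith
    then show ?thesis
      by (simp add: f_B g_fin real_f[OF eff_domain_finite[OF f_proper x(1)]] real_g[OF eff_domain_finite[OF g_proper x(2)]])
  qed
  show ?thesis
    using part1 part2 unfolding R_eq r_def D_def by blast
qed

end
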